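(* Let $c$ be a tetrahedron, with set of faces $F(c)$ and set of edges $E(c)$. Then $$\sum_{f \in F(c)} \tilde{\boldsymbol e}_{f|c} \otimes \boldsymbol f = |c|\, \mathbb I_3, \qquad \sum_{e \in E(c)} \tilde{\boldsymbol f}_{e|c} \otimes \boldsymbol e = |c|\, \mathbb I_3 ,$$ where $\boldsymbol e,\boldsymbol f$ are the vectors of the edges and faces of $c$, and $\tilde{\boldsymbol e}_{f|c}$, $\tilde{\boldsymbol f}_{e|c}$ are the vectors of the corresponding barycentric dual edges and dual faces restricted to $c$.
   Context: All vectors are column vectors in $\mathbb R^3$; $\boldsymbol a\otimes\boldsymbol b=\boldsymbol a\boldsymbol b^T$; $\mathbb I_3$ is the $3\times 3$ identity. $c$ is a nondegenerate tetrahedron with volume $|c|$. Each edge and face of $c$ carries a fixed, arbitrarily chosen orientation. $\boldsymbol b_e,\boldsymbol b_f,\boldsymbol b_c$ denote the barycenters of the edge $e$, the face $f$, and $c$; write $\tilde{\boldsymbol n}_c=\boldsymbol b_c$ (the dual node). - Edge vector: $\boldsymbol e$ is the difference of the two endpoints of $e$, oriented as $e$. - Face vector: $\boldsymbol f=|f|\,\boldsymbol n_f$, with $|f|$ the area and $\boldsymbol n_f$ the unit normal to $f$ given by the orientation of $f$. - Restricted dual edge: $\tilde e_{f|c}$ is the segment joining $\tilde{\boldsymbol n}_c$ and $\boldsymbol b_f$. Its vector is $\tilde{\boldsymbol e}_{f|c}=\pm(\boldsymbol b_f-\tilde{\boldsymbol n}_c)$, with the sign chosen so that $\tilde{\boldsymbol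 e}_{f|c}\cdot\boldsymbol f>0$ (it is $+$ when $\boldsymbol n_f$ points out of $c$). - Restricted dual face: $\tilde f_{e|c}$ is the plane quadrilateral with vertices $\tilde{\boldsymbol n}_c,\boldsymbol b_{f_i},\boldsymbol b_e,\boldsymbol b_{f_j}$, where $f_i,f_j$ are the two faces of $c$ with $e=f_i\cap f_j$. Its face vector (area times unit normal) is $\tilde{\boldsymbol f}_{e|c}=\tfrac12\big((\boldsymbol b_{f_i}-\tilde{\boldsymbol n}_c)\times(\boldsymbol b_e-\tilde{\boldsymbol n}_c)-(\boldsymbol b_{f_j}-\tilde{\boldsymbol n}_c)\times(\boldsymbol b_e-\tilde{\boldsymbol n}_c)\big)$, with $f_i,f_j$ ordered so that $\tilde{\boldsymbol f}_{e|c}\cdot\boldsymbol e>0$. *)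

theory Defs
  imports "HOL-Analysis.Analysis"
begin

text \<open>For a simplex the extreme points are its vertices, so this is the usual barycenter.\<close>

definition barycenter :: "(real^3) set \<Rightarrow> real^3" where
  "barycenter S = (1 / real (card {v. v extreme_point_of S})) *\<^sub>R (\<Sum>v | v extreme_point_of S. v)"

text \<open>
  The area of a planar set in space is the Lebesgue measure of its preimage in the
  coordinates of an orthonormal frame of a plane containing it; it does not depend on the frame.
\<close>

definition is_area :: "(real^3) set \<Rightarrow> real \<Rightarrow> bool" where
  "is_area S m \<longleftrightarrow> (\<exists>p u w. \<exists>T::(real^2) set. norm u = 1 \<and> norm w = 1 \<and> u \<bullet> w = 0 \<and>
     S = (\<lambda>x. p + x $ 1 *\<^sub>R u + x $ 2 *\<^sub>R w) ` T \<and> m = measure lebesgue T)"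

definition area :: "(real^3) set \<Rightarrow> real" where
  "area S = (THE m. is_area S m)"

definition unit_normal :: "(real^3) set \<Rightarrow> real^3 \<Rightarrow> bool" where
  "unit_normal f n \<longleftrightarrow> norm n = 1 \<and> (\<forall>x\<in>f. \<forall>y\<in>f. n \<bullet> (x - y) = 0)"

text \<open>The vector of the face \<open>f\<close> oriented by its unit normal \<open>n\<close>.\<close>

definition face_vector :: "(real^3) set \<Rightarrow> real^3 \<Rightarrow> real^3" where
  "face_vector f n = area f *\<^sub>R n"

text \<open>
  Below, \<open>fv\<close> and \<open>ev\<close> are the vectors of the face \<open>f\<close> and the edge \<open>e\<close>; they
  only determine the sign of the dual vector.
\<close>

definition dual_edge_vector :: "(real^3) set \<Rightarrow> (real^3) set \<Rightarrow> real^3 \<Rightarrow> real^3" where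
  "dual_edge_vector c f fv =
     (THE d. (d = barycenter f - barycenter c \<or> d = - (barycenter f - barycenter c)) \<and> d \<bullet> fv > 0)"

definition dual_face_vector :: "(real^3) set \<Rightarrow> (real^3) set \<Rightarrow> real^3 \<Rightarrow> real^3" where
  "dual_face_vector c e ev =
     (THE d. (\<exists>f g. f facet_of c \<and> g facet_of c \<and> f \<noteq> g \<and> e = f \<inter> g \<and>
        d = (1/2) *\<^sub>R (cross3 (barycenter f - barycenter c) (barycenter e - barycenter c)
                      - cross3 (barycenter g - barycenter c) (barycenter e - barycenter c)))
        \<and> d \<bullet> ev > 0)"

definition tensor :: "real^3 \<Rightarrow> real^3 \<Rightarrow> real^3^3" where
  "tensor a b = (columnvector a :: real^1^3) ** (rowvector b :: real^3^1)"

end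

theory Submission
  imports Defs
begin

text \<open>
  Reversing the orientation of a face or an edge changes the sign of both factors of its
  summand. Hence each summand is the sign of the signed volume times a tensor that is polynomial
  in the vertices; it remains to determine that sign and to check that the signed sums of these
  polynomial tensors are multiples of the identity.
\<close>

section \<open>Tensor products and the signed volume of a tetrahedron\<close>

lemma tensor_nth [simp]: "tensor a b $ i $ j = a $ i * b $ j"
  by (simp add: tensor_def columnvector_def rowvector_def matrix_matrix_mult_def)

lemma tensor_scaleR: "tensor (r *\<^sub>R a) (s *\<^sub>R b) = (r * s) *\<^sub>R tensor a b"
  by (simp add: vec_eq_iff)

text \<open>The sign depends on the order of the vertices, so the summands of all faces and edges
  can be compared with one fixed order.\<close>

definition signed_volume :: "real^3 \<Rightarrow> real^3 \<Rightarrow> real^3 \<Rightarrow> real^3 \<Rightarrow> real" where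
  "signed_volume a b c d = (b - a) \<bullet> cross3 (c - a) (d - a) / 6"

text \<open>Up to sign, the volume of a simplex is the determinant of its edge vectors at one vertex
  divided by \<open>3!\<close>; that determinant is the triple product.\<close>

lemma content_tetrahedron:
  assumes "distinct [a, b, c, d]"
  shows "measure lebesgue (convex hull {a, b, c, d}) = \<bar>signed_volume a b c d\<bar>"
proof -
  \<comment> \<open>The vertices other than \<open>a\<close>, indexed by the type \<open>3\<close>,
    so that their differences from \<open>a\<close> form the columns of a matrix.\<close>
  define f :: "3 \<Rightarrow> real^3" where "f = (\<lambda>i. if i = 1 then b else if i = 2 then c else d)"
  have f: "f 1 = b" "f 2 = c" "f 3 = d"
    by (simp_all add: f_def)
  have "inj f"
    using assms by (auto simp: inj_def forall_3 f)
  moreover have "range f = {a, b, c, d} - {a}"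
    using assms by (auto simp: UNIV_3 f)
  ultimately have "bij_betw f UNIV ({a, b, c, d} - {a})"
    by (simp add: bij_betw_def)
  moreover have "compact (convex hull {a, b, c, d})"
    by (simp add: finite_imp_compact_convex_hull)
  ultimately have "measure lebesgue (convex hull {a, b, c, d}) = 
      \<bar>det (\<chi> i j. f j $ i - a $ i)\<bar> / fact CARD(3)"
    using content_simplex[of "{a, b, c, d}" a f] assms by (auto dest: compact_imp_closed)
  also have "det (\<chi> i j. f j $ i - a $ i) = 6 * signed_volume a b c d"
    by (simp add: f signed_volume_def det_3 cross3_def inner_vec_def sum_3 algebra_simps)
  finally show ?thesis by (simp add: fact_numeral abs_mult)
qed

text \<open>Affine independence gives the hull dimension 3, whereas a convex set with empty interior
  lies in a plane. So the interior is nonempty and the volume is not zero.\<close>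

lemma signed_volume_nonzero:
  assumes "\<not> affine_dependent {a, b, c, d}" "distinct [a, b, c, d]"
  shows "signed_volume a b c d \<noteq> 0"
proof -
  let ?c = "convex hull {a, b, c, d}"
  have "aff_dim ?c = 3"
    using affine_independent_iff_card[of "{a, b, c, d}"] assms by (simp add: aff_dim_convex_hull)
  have "interior ?c \<noteq> {}"
  proof
    assume "interior ?c = {}"
    then obtain n t where "n \<noteq> 0" "?c \<subseteq> {x. n \<bullet> x = t}"
      using empty_interior_subset_hyperplane by (metis convex_convex_hull)
    then have "aff_dim ?c \<le> 2"
      using aff_dim_subset[of ?c "{x. n \<bullet> x = t}"] by simp
    with \<open>aff_dim ?c = 3\<close> show False by simp
  qed
  then have "\<not> negligible ?c"
    by (simp add: negligible_convex_interior)
  moreover have "?c \<in> lmeasurable"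
    by (simp add: finite_imp_compact_convex_hull lmeasurable_compact)
  ultimately show ?thesis
    using content_tetrahedron[OF assms(2)] by (auto simp: negligible_iff_measure)
qed

section \<open>Area and oriented normal of a triangle\<close>

lemma norm_cross3_orthonormal:
  assumes "norm u = 1" "norm w = 1" "u \<bullet> w = 0"
  shows "norm (cross3 u w) = 1"
proof (rule power2_eq_imp_eq)
  show "(norm (cross3 u w))\<^sup>2 = 1\<^sup>2"
    using norm_cross_dot[of u w] assms by simp
qed simp_all

text \<open>Links area in plane coordinates, a 2 by 2 determinant, to the norm of a cross product in
  space.\<close>

lemma cross3_combination:
  "cross3 (x *\<^sub>R u + y *\<^sub>R w) (z *\<^sub>R u + t *\<^sub>R w) = (x * t - y * z) *\<^sub>R cross3 u w"
  by (simp add: cross3_simps)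

lemma convex_hull_affine_image:
  "linear g \<Longrightarrow> convex hull ((\<lambda>x. a + g x) ` S) = (\<lambda>x. a + g x) ` (convex hull S)"
  by (metis convex_hull_linear_image convex_hull_translation image_image)

text \<open>The frame map is affine and injective, so \<open>T\<close> must be the triangle of the
  coordinates of \<open>a\<close>, \<open>b\<close>, \<open>c\<close>. Its content is half a
  determinant, which the orthonormal frame turns into half the norm of the cross product, whatever
  the frame.\<close>

lemma is_area_triangle_unique:
  assumes "is_area (convex hull {a, b, c}) m"
  shows "m = norm (cross3 (b - a) (c - a)) / 2"
proof -
  obtain p u w T where uw: "norm u = 1" "norm w = 1" "u \<bullet> w = 0"
    and im: "convex hull {a, b, c} = (\<lambda>x::real^2. p + x $ 1 *\<^sub>R u + x $ 2 *\<^sub>R w) ` T"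
    and m: "m = measure lebesgue T"
    using assms unfolding is_area_def by blast
  define g where "g = (\<lambda>x::real^2. x $ 1 *\<^sub>R u + x $ 2 *\<^sub>R w)"
  have fg: "(\<lambda>x::real^2. p + x $ 1 *\<^sub>R u + x $ 2 *\<^sub>R w) = (\<lambda>x. p + g x)"
    by (simp add: g_def add.assoc)
  have "linear g"
    by (rule linearI) (simp_all add: g_def algebra_simps)
  \<comment> \<open>Inner products with the frame recover the coordinates; injectivity
    follows.\<close>
  have coord: "g x \<bullet> u = x $ 1 \<and> g x \<bullet> w = x $ 2" for x
    using uw by (simp add: g_def inner_add_left inner_commute[of w u] dot_square_norm)
  have "x = y" if "g x = g y" for x y
  proof -
    have "x $ 1 = y $ 1" "x $ 2 = y $ 2"
      using coord[of x] coord[of y] that by simp_all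
    then show ?thesis by (simp add: vec_eq_iff forall_2)
  qed
  then have "inj g" by (simp add: injI)
  then have injf: "inj (\<lambda>x. p + g x)" by (auto simp: inj_def)
  have "{a, b, c} \<subseteq> range (\<lambda>x. p + g x)"
    using hull_subset[of "{a, b, c}" convex] im unfolding fg by blast
  then have ran: "a \<in> range (\<lambda>x. p + g x)" "b \<in> range (\<lambda>x. p + g x)" "c \<in> range (\<lambda>x. p + g x)"
    by simp_all
  from ran(1) obtain A where A: "a = p + g A" by (rule rangeE)
  from ran(2) obtain B where B: "b = p + g B" by (rule rangeE)
  from ran(3) obtain C where C: "c = p + g C" by (rule rangeE)
  note ABC = A B C
  have "(\<lambda>x. p + g x) ` T = convex hull {a, b, c}"
    using im unfolding fg by (rule sym)
  also have "{a, b, c} = (\<lambda>x. p + g x) ` {A, B, C}"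
    using ABC by auto
  also have "convex hull \<dots> = (\<lambda>x. p + g x) ` (convex hull {A, B, C})"
    using \<open>linear g\<close> by (rule convex_hull_affine_image)
  finally have "T = convex hull {A, B, C}"
    using injf by (simp add: inj_image_eq_iff)
  moreover have "compact (convex hull {A, B, C})"
    by (simp add: finite_imp_compact_convex_hull)
  ultimately have "m = \<bar>(C $ 1 - A $ 1) * (B $ 2 - A $ 2) - (B $ 1 - A $ 1) * (C $ 2 - A $ 2)\<bar> / 2"
    using m content_triangle[of A B C] by (auto dest: compact_imp_closed)
  moreover have "b - a = (B $ 1 - A $ 1) *\<^sub>R u + (B $ 2 - A $ 2) *\<^sub>R w"
    "c - a = (C $ 1 - A $ 1) *\<^sub>R u + (C $ 2 - A $ 2) *\<^sub>R w"
    by (simp_all add: ABC g_def algebra_simps)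
  ultimately show ?thesis
    using norm_cross3_orthonormal[OF uw] by (simp add: cross3_combination mult.commute abs_minus_commute)
qed

text \<open>Gram-Schmidt applied to \<open>b - a\<close> and \<open>c - a\<close> yields a frame;
  the nonzero cross product keeps both vectors of the process from vanishing.\<close>

lemma is_area_triangle_exists:
  assumes "cross3 (b - a) (c - a) \<noteq> 0"
  shows "\<exists>m. is_area (convex hull {a, b, c}) m"
proof -
  define x y where "x = b - a" and "y = c - a"
  define u where "u = x /\<^sub>R norm x"
  define z where "z = y - (y \<bullet> u) *\<^sub>R u"
  define w where "w = z /\<^sub>R norm z"
  have "x \<noteq> 0" using assms by (auto simp: x_def)
  then have x: "x = norm x *\<^sub>R u" and u: "norm u = 1"
    by (simp_all add: u_def)
  have "z \<noteq> 0"
  proof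
    assume "z = 0"
    then have "cross3 x y = cross3 x ((y \<bullet> u) *\<^sub>R u)" by (simp add: z_def)
    also have "\<dots> = 0" by (simp add: u_def cross_mult_right)
    finally show False using assms by (simp add: x_def y_def)
  qed
  then have y: "y = (y \<bullet> u) *\<^sub>R u + norm z *\<^sub>R w" and w: "norm w = 1"
    by (simp_all add: w_def z_def)
  have uw: "u \<bullet> w = 0"
    using u by (simp add: w_def z_def inner_diff_right inner_commute dot_square_norm)
  define g where "g = (\<lambda>x::real^2. x $ 1 *\<^sub>R u + x $ 2 *\<^sub>R w)"
  have "linear g"
    by (rule linearI) (simp_all add: g_def algebra_simps)
  \<comment> \<open>The coordinates of \<open>a\<close>, \<open>b\<close>, \<open>c\<close> in the
    frame with origin \<open>a\<close>.\<close>
  define T :: "(real^2) set" where "T = convex hull {0, vector [norm x, 0], vector [y \<bullet> u, norm z]}"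
  have "b = a + g (vector [norm x, 0])"
    using x by (simp add: g_def x_def algebra_simps)
  moreover have "c = a + g (vector [y \<bullet> u, norm z])"
    unfolding g_def vector_2 y[symmetric] by (simp add: y_def)
  moreover have "a = a + g 0"
    by (simp add: g_def)
  ultimately have "{a, b, c} = (\<lambda>x. a + g x) ` {0, vector [norm x, 0], vector [y \<bullet> u, norm z]}"
    by (metis image_empty image_insert)
  then have "convex hull {a, b, c} = (\<lambda>x. a + g x) ` T"
    unfolding T_def using \<open>linear g\<close>
    by (simp only: convex_hull_affine_image)
  then have "convex hull {a, b, c} = (\<lambda>x. a + x $ 1 *\<^sub>R u + x $ 2 *\<^sub>R w) ` T"
    by (simp add: g_def add.assoc)
  with u w uw show ?thesis
    unfolding is_area_def by blast
qed

lemma area_triangle: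
  assumes "cross3 (b - a) (c - a) \<noteq> 0"
  shows "area (convex hull {a, b, c}) = norm (cross3 (b - a) (c - a)) / 2"
proof -
  obtain m where m: "is_area (convex hull {a, b, c}) m"
    using is_area_triangle_exists[OF assms] by blast
  then have "area (convex hull {a, b, c}) = m"
    unfolding area_def using is_area_triangle_unique by (intro the_equality) blast+
  with m show ?thesis using is_area_triangle_unique by simp
qed

text \<open>A unit normal is parallel to the cross product of two sides, and the area is half the
  norm of that product, so the norms cancel. Only the sign \<open>s\<close> remembers the
  orientation.\<close>

lemma face_vector_triangle:
  assumes N: "cross3 (b - a) (c - a) \<noteq> 0" and n: "unit_normal (convex hull {a, b, c}) n"
  obtains s :: real where "\<bar>s\<bar> = 1"
    "face_vector (convex hull {a, b, c}) n = s *\<^sub>R ((1/2) *\<^sub>R cross3 (b - a) (c - a))"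
proof -
  let ?N = "cross3 (b - a) (c - a)"
  have abc: "a \<in> convex hull {a, b, c}" "b \<in> convex hull {a, b, c}" "c \<in> convex hull {a, b, c}"
    by (simp_all add: hull_inc)
  have orth: "norm n = 1" "n \<bullet> (b - a) = 0" "n \<bullet> (c - a) = 0"
    using n abc unfolding unit_normal_def by blast+
  \<comment> \<open>The triple product expansion shows that \<open>n\<close> is parallel to
    \<open>?N\<close>.\<close>
  have "cross3 n ?N = (n \<bullet> (c - a)) *\<^sub>R (b - a) - (n \<bullet> (b - a)) *\<^sub>R (c - a)"
    by (rule Lagrange)
  then have "cross3 n ?N = 0" using orth by simp
  then have "(n \<bullet> ?N)\<^sup>2 = (norm ?N)\<^sup>2"
    using norm_cross_dot[of n ?N] orth(1) by simp
  then have "\<bar>n \<bullet> ?N\<bar>\<^sup>2 = (norm ?N)\<^sup>2"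
    by simp
  then have abs: "\<bar>n \<bullet> ?N\<bar> = norm ?N"
    by (rule power2_eq_imp_eq) simp_all
  \<comment> \<open>A second expansion gives the factor of proportionality.\<close>
  have "cross3 n (cross3 n ?N) = (n \<bullet> ?N) *\<^sub>R n - (n \<bullet> n) *\<^sub>R ?N"
    by (rule Lagrange)
  then have "(n \<bullet> ?N) *\<^sub>R n = ?N"
    using \<open>cross3 n ?N = 0\<close> orth(1) by (simp add: dot_square_norm)
  moreover define t where "t = n \<bullet> ?N"
  ultimately have tn: "t *\<^sub>R n = ?N" and t: "\<bar>t\<bar> = norm ?N"
    using abs by simp_all
  have "face_vector (convex hull {a, b, c}) n = (\<bar>t\<bar> / 2) *\<^sub>R n"
    by (simp only: face_vector_def area_triangle[OF N] t)
  also have "\<dots> = (sgn t * (1/2)) *\<^sub>R (t *\<^sub>R n)"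
    by (simp add: abs_sgn mult.commute)
  also have "\<dots> = sgn t *\<^sub>R ((1/2) *\<^sub>R ?N)"
    unfolding tn by simp
  finally have "face_vector (convex hull {a, b, c}) n = sgn t *\<^sub>R ((1/2) *\<^sub>R ?N)" .
  moreover have "\<bar>sgn t\<bar> = 1"
    using t N by (auto simp: abs_sgn_eq)
  ultimately show ?thesis using that by blast
qed

section \<open>Barycenters, the choice of sign, and dual edges\<close>

lemma barycenter_convex_hull:
  assumes "\<not> affine_dependent S"
  shows "barycenter (convex hull S) = (1 / real (card S)) *\<^sub>R \<Sum>S"
  using assms by (simp add: barycenter_def extreme_point_of_convex_hull_affine_independent)

text \<open>The selected vector is \<open>s * sgn (x \<bullet> v)\<close> times \<open>x\<close>.
  The orientation \<open>s\<close> then occurs twice in the tensor and cancels, since its square is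
  1.\<close>

lemma tensor_positive_choice:
  assumes "x \<bullet> v \<noteq> 0" "\<bar>s\<bar> = 1"
  shows "tensor (THE d. (d = x \<or> d = - x) \<and> d \<bullet> (s *\<^sub>R v) > 0) (s *\<^sub>R v) = sgn (x \<bullet> v) *\<^sub>R tensor x v"
proof -
  have s: "s = 1 \<or> s = -1" using assms(2) by linarith
  have "(THE d. (d = x \<or> d = - x) \<and> d \<bullet> (s *\<^sub>R v) > 0) = (s * sgn (x \<bullet> v)) *\<^sub>R x"
    using assms(1) s by (intro the_equality) (auto simp: sgn_if split: if_splits)
  then show ?thesis
    using s by (auto simp: tensor_scaleR)
qed

text \<open>Here \<open>a\<close> is the vertex opposite to the face. The difference of barycenters
  contributes 1/12 and the triangle area 1/2, whence 1/24.\<close>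

lemma dual_edge_tensor:
  assumes aff: "\<not> affine_dependent {a, b, c, d}" and dist: "distinct [a, b, c, d]"
    and n: "unit_normal (convex hull {b, c, d}) n"
  defines "F \<equiv> face_vector (convex hull {b, c, d}) n"
  shows "tensor (dual_edge_vector (convex hull {a, b, c, d}) (convex hull {b, c, d}) F) F =
    (sgn (signed_volume a b c d) / 24) *\<^sub>R tensor (b + c + d - 3 *\<^sub>R a) (cross3 (c - b) (d - b))"
proof -
  let ?N = "(1/2) *\<^sub>R cross3 (c - b) (d - b)" and ?x = "(1/12) *\<^sub>R (b + c + d - 3 *\<^sub>R a)"
  have "\<not> affine_dependent {b, c, d}"
    using aff by (meson affine_dependent_subset subset_insertI)
  then have x: "barycenter (convex hull {b, c, d}) - barycenter (convex hull {a, b, c, d}) = ?x"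
    using dist by (simp add: barycenter_convex_hull aff) (simp add: vec_eq_iff field_simps)
  \<comment> \<open>The vectors \<open>b - a\<close>, \<open>c - a\<close>, \<open>d - a\<close>
    have the same component along the face normal, because their differences lie in the face plane;
    hence the factor 3.\<close>
  have "(b + c + d - 3 *\<^sub>R a) \<bullet> cross3 (c - b) (d - b) = 3 * ((b - a) \<bullet> cross3 (c - a) (d - a))"
    by (simp add: cross3_simps)
  then have xN: "?x \<bullet> ?N = (3/4) * signed_volume a b c d"
    by (simp add: signed_volume_def)
  have V: "signed_volume a b c d \<noteq> 0"
    using signed_volume_nonzero[OF aff dist] .
  \<comment> \<open>The nonzero volume also rules out a degenerate face, so its area formula
    applies.\<close>
  with xN have "cross3 (c - b) (d - b) \<noteq> 0" by auto
  then obtain s :: real where s: "\<bar>s\<bar> = 1" "F = s *\<^sub>R ?N"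
    unfolding F_def using face_vector_triangle[OF _ n] by blast
  show ?thesis
    unfolding dual_edge_vector_def x s(2)
    using tensor_positive_choice[of ?x ?N s] s(1) V xN by (simp add: sgn_mult tensor_scaleR)
qed

section \<open>Facets and edges of a tetrahedron as sets of vertices\<close>

text \<open>Each vertex set is recovered from its hull as the set of extreme points.\<close>

lemma convex_hull_eq_iff_affine_independent:
  fixes V :: "'a::euclidean_space set"
  assumes "\<not> affine_dependent V" "S \<subseteq> V" "T \<subseteq> V"
  shows "convex hull S = convex hull T \<longleftrightarrow> S = T"
proof
  assume eq: "convex hull S = convex hull T"
  have "\<not> affine_dependent S" "\<not> affine_dependent T"
    using assms affine_dependent_subset by blast+
  then have "x \<in> S \<longleftrightarrow> x \<in> T" for x
    using extreme_point_of_convex_hull_affine_independent[of S x]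
      extreme_point_of_convex_hull_affine_independent[of T x] eq by simp
  then show "S = T" by blast
qed simp

lemma facets_tetrahedron:
  assumes aff: "\<not> affine_dependent {a, b, c, d}" and dist: "distinct [a, b, c, d]"
  shows "{f. f facet_of convex hull {a, b, c, d}} =
    (\<lambda>S. convex hull S) ` {{b, c, d}, {a, c, d}, {a, b, d}, {a, b, c}}"
proof -
  have "{a, b, c, d} - {a} = {b, c, d}" "{a, b, c, d} - {b} = {a, c, d}"
    "{a, b, c, d} - {c} = {a, b, d}" "{a, b, c, d} - {d} = {a, b, c}"
    using dist by auto
  moreover have "2 \<le> card {a, b, c, d}"
    using dist by simp
  then have "{f. f facet_of convex hull {a, b, c, d}} =
      (\<lambda>u. convex hull ({a, b, c, d} - {u})) ` {a, b, c, d}"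
    unfolding facet_of_convex_hull_affine_independent_alt[OF aff] by blast
  ultimately show ?thesis
    by (simp only: image_insert image_empty)
qed

text \<open>Faces of a simplex are the hulls of subsets of its vertices. These subsets are affinely
  independent, so dimension 1 means two elements.\<close>

lemma edges_tetrahedron:
  assumes aff: "\<not> affine_dependent {a, b, c, d}" and dist: "distinct [a, b, c, d]"
  shows "{e. e edge_of convex hull {a, b, c, d}} =
    (\<lambda>S. convex hull S) ` {{a, b}, {a, c}, {a, d}, {b, c}, {b, d}, {c, d}}"
proof -
  have edge: "e edge_of convex hull {a, b, c, d} \<longleftrightarrow> (\<exists>S \<subseteq> {a, b, c, d}. card S = 2 \<and> e = convex hull S)" for e
  proof -
    have "aff_dim S = 1 \<longleftrightarrow> card S = 2" if "S \<subseteq> {a, b, c, d}" for S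
      using affine_independent_iff_card[of S] affine_dependent_subset[OF _ that] aff by auto
    then show ?thesis
      by (auto simp: edge_of_def face_of_convex_hull_affine_independent[OF aff] aff_dim_convex_hull)
  qed
  have "{e. e edge_of convex hull {a, b, c, d}} =
      (\<lambda>S. convex hull S) ` {S. S \<subseteq> {a, b, c, d} \<and> card S = 2}"
    by (simp only: edge image_def Bex_def mem_Collect_eq conj_assoc)
  moreover have "{S. S \<subseteq> {a, b, c, d} \<and> card S = 2} = {{a, b}, {a, c}, {a, d}, {b, c}, {b, d}, {c, d}}"
    (is "?L = ?R")
  proof
    show "?L \<subseteq> ?R"
    proof
      fix S assume "S \<in> ?L"
      then obtain x y where "S = {x, y}" "x \<noteq> y" "x \<in> {a, b, c, d}" "y \<in> {a, b, c, d}"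
        by (auto simp: card_2_iff)
      then show "S \<in> ?R"
        by (elim insertE emptyE) (simp_all add: insert_commute)
    qed
    show "?R \<subseteq> ?L" using dist by simp
  qed
  ultimately show ?thesis by simp
qed

section \<open>Dual faces\<close>

text \<open>Here \<open>c\<close> and \<open>d\<close> are the vertices off the edge. Bilinearity
  merges the two cross products into one; the factors 1/2, 1/3 and 1/4 give 1/24. Exchanging the two
  faces or the two ends only changes signs, which the positive choice absorbs.\<close>

lemma dual_face_tensor:
  assumes aff: "\<not> affine_dependent {a, b, c, d}" and dist: "distinct [a, b, c, d]"
    and seg: "convex hull {a, b} = closed_segment t h"
  shows "tensor (dual_face_vector (convex hull {a, b, c, d}) (convex hull {a, b}) (h - t)) (h - t) =
    (sgn (signed_volume a b c d) / 24) *\<^sub>R tensor (cross3 (d - c) (a + b - c - d)) (b - a)"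
proof -
  let ?C = "convex hull {a, b, c, d}"
  let ?x = "(1/24) *\<^sub>R cross3 (d - c) (a + b - c - d)"
  let ?v = "\<lambda>f g. (1/2) *\<^sub>R (cross3 (barycenter f - barycenter ?C) (barycenter (convex hull {a, b}) - barycenter ?C)
                      - cross3 (barycenter g - barycenter ?C) (barycenter (convex hull {a, b}) - barycenter ?C))"
  have "{t, h} = {a, b}"
    using seg by (metis closed_segment_eq segment_convex_hull)
  then obtain s :: real where s: "\<bar>s\<bar> = 1" "h - t = s *\<^sub>R (b - a)"
    using that[of 1] that[of "-1"] by (auto simp: doubleton_eq_iff)
  have ind: "\<not> affine_dependent S" if "S \<subseteq> {a, b, c, d}" for S
    using aff that affine_dependent_subset by blast
  have inj: "convex hull S = convex hull T \<longleftrightarrow> S = T" if "S \<subseteq> {a, b, c, d}" "T \<subseteq> {a, b, c, d}" for S T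
    using convex_hull_eq_iff_affine_independent[OF aff that] .
  have int: "convex hull S \<inter> convex hull T = convex hull (S \<inter> T)" if "S \<subseteq> {a, b, c, d}" "T \<subseteq> {a, b, c, d}" for S T
    using convex_hull_Int[of S T] ind[of "S \<union> T"] that by simp
  have bary: "barycenter (convex hull S) = (1 / real (card S)) *\<^sub>R \<Sum>S" if "S \<subseteq> {a, b, c, d}" for S
    using barycenter_convex_hull ind[OF that] .
  \<comment> \<open>Exactly two facets meet in the edge. Hulls of vertex subsets intersect in the
    hull of the common vertices, so this is a question about vertex sets, settled by cases.\<close>
  have "(f facet_of ?C \<and> g facet_of ?C \<and> f \<noteq> g \<and> convex hull {a, b} = f \<inter> g) \<longleftrightarrow>
      (f = convex hull {a, b, c} \<and> g = convex hull {a, b, d}) \<or>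
      (f = convex hull {a, b, d} \<and> g = convex hull {a, b, c})" for f g
  proof -
    define Fs where "Fs = {{b, c, d}, {a, c, d}, {a, b, d}, {a, b, c}}"
    have Fs: "f facet_of ?C \<longleftrightarrow> (\<exists>S\<in>Fs. f = convex hull S)" for f
      using facets_tetrahedron[OF aff dist] unfolding Fs_def[symmetric] by blast
    have sub: "S \<subseteq> {a, b, c, d}" if "S \<in> Fs" for S
      using that unfolding Fs_def by auto
    have pair: "(S \<in> Fs \<and> T \<in> Fs \<and> S \<noteq> T \<and> {a, b} = S \<inter> T) \<longleftrightarrow>
        (S = {a, b, c} \<and> T = {a, b, d}) \<or> (S = {a, b, d} \<and> T = {a, b, c})" for S T
    proof
      assume L: "S \<in> Fs \<and> T \<in> Fs \<and> S \<noteq> T \<and> {a, b} = S \<inter> T"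
      then have "a \<in> S" "b \<in> S" "a \<in> T" "b \<in> T" by blast+
      with L dist show "(S = {a, b, c} \<and> T = {a, b, d}) \<or> (S = {a, b, d} \<and> T = {a, b, c})"
        unfolding Fs_def by (elim conjE insertE emptyE) simp_all
    next
      assume R: "(S = {a, b, c} \<and> T = {a, b, d}) \<or> (S = {a, b, d} \<and> T = {a, b, c})"
      have "{a, b, c} \<inter> {a, b, d} = {a, b}" "{a, b, d} \<inter> {a, b, c} = {a, b}"
        "c \<in> {a, b, c}" "c \<notin> {a, b, d}"
        using dist by auto
      with R show "S \<in> Fs \<and> T \<in> Fs \<and> S \<noteq> T \<and> {a, b} = S \<inter> T" unfolding Fs_def by auto
    qed
    have "(f facet_of ?C \<and> g facet_of ?C \<and> f \<noteq> g \<and> convex hull {a, b} = f \<inter> g) \<longleftrightarrow>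
      (\<exists>S T. (S \<in> Fs \<and> T \<in> Fs \<and> S \<noteq> T \<and> {a, b} = S \<inter> T) \<and> f = convex hull S \<and> g = convex hull T)"
      (is "?L \<longleftrightarrow> ?R")
    proof
      assume ?L
      then obtain S T where ST: "S \<in> Fs" "T \<in> Fs" "f = convex hull S" "g = convex hull T"
        "S \<noteq> T" "convex hull {a, b} = convex hull S \<inter> convex hull T"
        unfolding Fs by blast
      then have "{a, b} = S \<inter> T"
        using int[OF sub sub, OF ST(1,2)] inj[of "{a, b}" "S \<inter> T"] sub[OF ST(1)] by auto
      with ST show ?R by blast
    next
      assume ?R
      then obtain S T where ST: "S \<in> Fs" "T \<in> Fs" "S \<noteq> T" "{a, b} = S \<inter> T"
        "f = convex hull S" "g = convex hull T"
        by blast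
      have "f \<noteq> g" "f \<inter> g = convex hull {a, b}"
        using int[OF sub sub, OF ST(1,2)] inj[OF sub sub, OF ST(1,2)] ST(3-6) by auto
      with ST show ?L unfolding Fs by blast
    qed
    then show ?thesis unfolding pair by blast
  qed
  \<comment> \<open>The second factor is common to both products, so the barycenter of
    \<open>?C\<close> drops out of the first.\<close>
  moreover have v: "?v f g = (1/2) *\<^sub>R cross3 (barycenter f - barycenter g)
      (barycenter (convex hull {a, b}) - barycenter ?C)" for f g
    by (simp flip: Cross3.left_diff_distrib)
  have cd: "barycenter (convex hull {a, b, d}) - barycenter (convex hull {a, b, c}) = (1/3) *\<^sub>R (d - c)"
    using dist by (simp add: bary) (simp add: vec_eq_iff field_simps)
  have ab: "barycenter (convex hull {a, b}) - barycenter ?C = (1/4) *\<^sub>R (a + b - c - d)"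
    using dist by (simp add: bary) (simp add: vec_eq_iff field_simps)
  have vx: "?v (convex hull {a, b, d}) (convex hull {a, b, c}) = ?x"
    unfolding v unfolding cd ab by (simp add: cross_mult_left cross_mult_right)
  moreover have "?v (convex hull {a, b, c}) (convex hull {a, b, d}) = - ?x"
    unfolding vx[symmetric] by (simp add: algebra_simps)
  \<comment> \<open>The two orders of the faces give opposite vectors, so the candidates are those
    of \<open>tensor_positive_choice\<close>.\<close>
  ultimately have ex: "(\<exists>f g. f facet_of ?C \<and> g facet_of ?C \<and> f \<noteq> g \<and> convex hull {a, b} = f \<inter> g \<and> y = ?v f g)
      \<longleftrightarrow> y = ?x \<or> y = - ?x" for y
    by metis
  have "cross3 (d - c) (a + b - c - d) \<bullet> (b - a) = 2 * ((b - a) \<bullet> cross3 (c - a) (d - a))"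
    by (simp add: cross3_simps)
  then have xv: "?x \<bullet> (b - a) = (1/2) * signed_volume a b c d"
    by (simp add: signed_volume_def)
  have V: "signed_volume a b c d \<noteq> 0"
    using signed_volume_nonzero[OF aff dist] .
  have D: "dual_face_vector ?C (convex hull {a, b}) (h - t) =
      (THE y. (y = ?x \<or> y = - ?x) \<and> y \<bullet> (s *\<^sub>R (b - a)) > 0)"
    unfolding dual_face_vector_def s(2) ex[symmetric] by (simp only: ex_simps conj_assoc)
  show ?thesis
    unfolding D unfolding s(2)
    using tensor_positive_choice[of ?x "b - a" s] s(1) V xv by (simp add: sgn_mult tensor_scaleR[of _ _ 1, simplified])
qed

section \<open>Signs of vertex orders and polynomial tensor identities\<close>

text \<open>Each sign is the parity of the reordering. The first three orders put the vertex
  opposite to a face in front, the others the two ends of an edge.\<close>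

lemma signed_volume_permute:
  "signed_volume b a c d = - signed_volume a b c d"
  "signed_volume c a b d = signed_volume a b c d"
  "signed_volume d a b c = - signed_volume a b c d"
  "signed_volume a c b d = - signed_volume a b c d"
  "signed_volume a d b c = signed_volume a b c d"
  "signed_volume b c a d = signed_volume a b c d"
  "signed_volume b d a c = - signed_volume a b c d"
  "signed_volume c d a b = signed_volume a b c d"
  by (simp_all add: signed_volume_def cross3_def inner_vec_def sum_3 field_simps)

text \<open>The signs are the parities for the vertex opposite to each face. The factor on the right
  is 24 times the signed volume, matching the 1/24 of each summand; expanding the nine entries
  proves it.\<close>

lemma face_tensor_sum:
  "tensor (b + c + d - 3 *\<^sub>R a) (cross3 (c - b) (d - b))
     - tensor (a + c + d - 3 *\<^sub>R b) (cross3 (c - a) (d - a))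
     + tensor (a + b + d - 3 *\<^sub>R c) (cross3 (b - a) (d - a))
     - tensor (a + b + c - 3 *\<^sub>R d) (cross3 (b - a) (c - a))
   = (4 * ((b - a) \<bullet> cross3 (c - a) (d - a))) *\<^sub>R mat 1"
  by (simp add: vec_eq_iff forall_3 mat_def cross3_def inner_vec_def sum_3 algebra_simps)

text \<open>The edge analogue: signs are the parities with the ends of the edge in front, and the
  factor is again 24 times the signed volume.\<close>

lemma edge_tensor_sum:
  "tensor (cross3 (d - c) (a + b - c - d)) (b - a)
     - tensor (cross3 (d - b) (a + c - b - d)) (c - a)
     + tensor (cross3 (c - b) (a + d - b - c)) (d - a)
     + tensor (cross3 (d - a) (b + c - a - d)) (c - b)
     - tensor (cross3 (c - a) (b + d - a - c)) (d - b)
     + tensor (cross3 (b - a) (c + d - a - b)) (d - c)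
   = (4 * ((b - a) \<bullet> cross3 (c - a) (d - a))) *\<^sub>R mat 1"
  by (simp add: vec_eq_iff forall_3 mat_def cross3_def inner_vec_def sum_3 algebra_simps)

section \<open>Summation over the faces and edges\<close>

theorem lemma1:
  fixes c :: "(real^3) set"
    and tail head :: "(real^3) set \<Rightarrow> real^3"
    and n :: "(real^3) set \<Rightarrow> real^3"
  assumes tetrahedron: "3 simplex c"
    and edge_orientation: "\<And>e. e edge_of c \<Longrightarrow> e = closed_segment (tail e) (head e)"
    and face_orientation: "\<And>f. f facet_of c \<Longrightarrow> unit_normal f (n f)"
  shows "((\<Sum>f | f facet_of c.
            tensor (dual_edge_vector c f (face_vector f (n f))) (face_vector f (n f)))
         = measure lebesgue c *\<^sub>R mat 1)
       \<and> ((\<Sum>e | e edge_of c.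
            tensor (dual_face_vector c e (head e - tail e)) (head e - tail e))
         = measure lebesgue c *\<^sub>R mat 1)"
proof -
  obtain V where V: "finite V" "\<not> affine_dependent V" "card V = 4" "c = convex hull V"
    using tetrahedron unfolding Polytope.simplex by auto
  \<comment> \<open>A fixed enumeration of the four vertices provides the reference sign.\<close>
  obtain xs where xs: "set xs = V" "distinct xs"
    using V(1) finite_distinct_list by blast
  then have "length xs = 4"
    using V(3) distinct_card by fastforce
  then obtain v0 v1 v2 v3 where "xs = [v0, v1, v2, v3]"
    by (auto simp: numeral_eq_Suc length_Suc_conv)
  with xs V have dist: "distinct [v0, v1, v2, v3]"
    and aff: "\<not> affine_dependent {v0, v1, v2, v3}" and c: "c = convex hull {v0, v1, v2, v3}"
    by simp_all
  let ?V = "{v0, v1, v2, v3}" and ?D = "signed_volume v0 v1 v2 v3"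
  have vol: "measure lebesgue c = \<bar>?D\<bar>"
    unfolding c by (rule content_tetrahedron[OF dist])
  \<comment> \<open>Allows both sums to be reindexed by vertex sets.\<close>
  have inj: "inj_on (\<lambda>S. convex hull S) (Pow ?V)"
    using convex_hull_eq_iff_affine_independent[OF aff] by (auto simp: inj_on_def)

  let ?Fs = "{{v1, v2, v3}, {v0, v2, v3}, {v0, v1, v3}, {v0, v1, v2}}"
  define G where "G f = tensor (dual_edge_vector c f (face_vector f (n f))) (face_vector f (n f))" for f
  \<comment> \<open>One formula serves all four faces, with \<open>x\<close> the opposite vertex;
    the chosen normal no longer appears.\<close>
  have G: "G (convex hull {y, z, w}) =
      (sgn (signed_volume x y z w) / 24) *\<^sub>R tensor (y + z + w - 3 *\<^sub>R x) (cross3 (z - y) (w - y))"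
    if "{y, z, w} \<in> ?Fs" "{x, y, z, w} = ?V" "distinct [x, y, z, w]" for x y z w
  proof -
    have "convex hull {y, z, w} facet_of c"
      using that(1) facets_tetrahedron[OF aff dist] unfolding c by blast
    then show ?thesis
      using dual_edge_tensor[of x y z w] that(2,3) aff face_orientation unfolding G_def c by simp
  qed
  have "(\<Sum>f | f facet_of c. G f) = (\<Sum>S\<in>?Fs. G (convex hull S))"
    unfolding c facets_tetrahedron[OF aff dist]
    by (rule sum.reindex_cong[OF inj_on_subset[OF inj]]) auto
  also have "\<dots> = G (convex hull {v1, v2, v3}) + G (convex hull {v0, v2, v3})
      + G (convex hull {v0, v1, v3}) + G (convex hull {v0, v1, v2})"
  proof -
    have "distinct [{v1, v2, v3}, {v0, v2, v3}, {v0, v1, v3}, {v0, v1, v2}]"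
      using dist by auto
    then show ?thesis by (simp add: add.assoc)
  qed
  also have "\<dots> = (sgn ?D / 24) *\<^sub>R
      (tensor (v1 + v2 + v3 - 3 *\<^sub>R v0) (cross3 (v2 - v1) (v3 - v1))
     - tensor (v0 + v2 + v3 - 3 *\<^sub>R v1) (cross3 (v2 - v0) (v3 - v0))
     + tensor (v0 + v1 + v3 - 3 *\<^sub>R v2) (cross3 (v1 - v0) (v3 - v0))
     - tensor (v0 + v1 + v2 - 3 *\<^sub>R v3) (cross3 (v1 - v0) (v2 - v0)))"
  proof -
    have "G (convex hull {v1, v2, v3}) = (sgn ?D / 24) *\<^sub>R
        tensor (v1 + v2 + v3 - 3 *\<^sub>R v0) (cross3 (v2 - v1) (v3 - v1))"
      using dist by (intro G) auto
    moreover have "G (convex hull {v0, v2, v3}) = (sgn (signed_volume v1 v0 v2 v3) / 24) *\<^sub>R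
        tensor (v0 + v2 + v3 - 3 *\<^sub>R v1) (cross3 (v2 - v0) (v3 - v0))"
      using dist by (intro G) auto
    moreover have "G (convex hull {v0, v1, v3}) = (sgn (signed_volume v2 v0 v1 v3) / 24) *\<^sub>R
        tensor (v0 + v1 + v3 - 3 *\<^sub>R v2) (cross3 (v1 - v0) (v3 - v0))"
      using dist by (intro G) auto
    moreover have "G (convex hull {v0, v1, v2}) = (sgn (signed_volume v3 v0 v1 v2) / 24) *\<^sub>R
        tensor (v0 + v1 + v2 - 3 *\<^sub>R v3) (cross3 (v1 - v0) (v2 - v0))"
      using dist by (intro G) auto
    ultimately show ?thesis
      by (simp only: signed_volume_permute[where a=v0 and b=v1 and c=v2 and d=v3]
          sgn_minus scaleR_add_right scaleR_diff_right minus_divide_left[symmetric] scaleR_minus_left)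
        simp
  qed
  \<comment> \<open>The 24 cancels, and \<open>sgn ?D * ?D\<close> is the absolute value.\<close>
  also have "\<dots> = \<bar>?D\<bar> *\<^sub>R mat 1"
    unfolding face_tensor_sum by (simp add: signed_volume_def sgn_mult sgn_divide abs_sgn mult.commute)
  finally have faces: "(\<Sum>f | f facet_of c. G f) = measure lebesgue c *\<^sub>R mat 1"
    unfolding vol .

  let ?Es = "{{v0, v1}, {v0, v2}, {v0, v3}, {v1, v2}, {v1, v3}, {v2, v3}}"
  define H where "H e = tensor (dual_face_vector c e (head e - tail e)) (head e - tail e)" for e
  \<comment> \<open>One formula serves all six edges, with \<open>z\<close> and \<open>w\<close> the
    remaining vertices; \<open>tail\<close> and \<open>head\<close> no longer appear.\<close>
  have H: "H (convex hull {x, y}) =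
      (sgn (signed_volume x y z w) / 24) *\<^sub>R tensor (cross3 (w - z) (x + y - z - w)) (y - x)"
    if "{x, y} \<in> ?Es" "{x, y, z, w} = ?V" "distinct [x, y, z, w]" for x y z w
  proof -
    have "convex hull {x, y} edge_of c"
      using that(1) edges_tetrahedron[OF aff dist] unfolding c by blast
    then have "convex hull {x, y} = closed_segment (tail (convex hull {x, y})) (head (convex hull {x, y}))"
      by (rule edge_orientation)
    from dual_face_tensor[OF _ that(3) this] aff show ?thesis
      unfolding H_def c that(2) by blast
  qed
  have "(\<Sum>e | e edge_of c. H e) = (\<Sum>S\<in>?Es. H (convex hull S))"
    unfolding c edges_tetrahedron[OF aff dist]
    by (rule sum.reindex_cong[OF inj_on_subset[OF inj]]) auto
  also have "\<dots> = H (convex hull {v0, v1}) + H (convex hull {v0, v2}) + H (convex hull {v0, v3})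
      + H (convex hull {v1, v2}) + H (convex hull {v1, v3}) + H (convex hull {v2, v3})"
  proof -
    have "distinct [{v0, v1}, {v0, v2}, {v0, v3}, {v1, v2}, {v1, v3}, {v2, v3}]"
      using dist by (auto simp: doubleton_eq_iff)
    then show ?thesis by (simp add: add.assoc)
  qed
  also have "\<dots> = (sgn ?D / 24) *\<^sub>R
      (tensor (cross3 (v3 - v2) (v0 + v1 - v2 - v3)) (v1 - v0)
     - tensor (cross3 (v3 - v1) (v0 + v2 - v1 - v3)) (v2 - v0)
     + tensor (cross3 (v2 - v1) (v0 + v3 - v1 - v2)) (v3 - v0)
     + tensor (cross3 (v3 - v0) (v1 + v2 - v0 - v3)) (v2 - v1)
     - tensor (cross3 (v2 - v0) (v1 + v3 - v0 - v2)) (v3 - v1)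
     + tensor (cross3 (v1 - v0) (v2 + v3 - v0 - v1)) (v3 - v2))"
  proof -
    have "H (convex hull {v0, v1}) = (sgn ?D / 24) *\<^sub>R
        tensor (cross3 (v3 - v2) (v0 + v1 - v2 - v3)) (v1 - v0)"
      using dist by (intro H) auto
    moreover have "H (convex hull {v0, v2}) = (sgn (signed_volume v0 v2 v1 v3) / 24) *\<^sub>R
        tensor (cross3 (v3 - v1) (v0 + v2 - v1 - v3)) (v2 - v0)"
      using dist by (intro H) auto
    moreover have "H (convex hull {v0, v3}) = (sgn (signed_volume v0 v3 v1 v2) / 24) *\<^sub>R
        tensor (cross3 (v2 - v1) (v0 + v3 - v1 - v2)) (v3 - v0)"
      using dist by (intro H) auto
    moreover have "H (convex hull {v1, v2}) = (sgn (signed_volume v1 v2 v0 v3) / 24) *\<^sub>R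
        tensor (cross3 (v3 - v0) (v1 + v2 - v0 - v3)) (v2 - v1)"
      using dist by (intro H) auto
    moreover have "H (convex hull {v1, v3}) = (sgn (signed_volume v1 v3 v0 v2) / 24) *\<^sub>R
        tensor (cross3 (v2 - v0) (v1 + v3 - v0 - v2)) (v3 - v1)"
      using dist by (intro H) auto
    moreover have "H (convex hull {v2, v3}) = (sgn (signed_volume v2 v3 v0 v1) / 24) *\<^sub>R
        tensor (cross3 (v1 - v0) (v2 + v3 - v0 - v1)) (v3 - v2)"
      using dist by (intro H) auto
    ultimately show ?thesis
      by (simp only: signed_volume_permute[where a=v0 and b=v1 and c=v2 and d=v3]
          sgn_minus scaleR_add_right scaleR_diff_right minus_divide_left[symmetric] scaleR_minus_left)
        simp
  qed
  also have "\<dots> = \<bar>?D\<bar> *\<^sub>R mat 1"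
    unfolding edge_tensor_sum by (simp add: signed_volume_def sgn_mult sgn_divide abs_sgn mult.commute)
  finally have "(\<Sum>e | e edge_of c. H e) = measure lebesgue c *\<^sub>R mat 1"
    unfolding vol .
  with faces show ?thesis
    unfolding G_def H_def by blast
qed

end
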